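(* Let $d<0$ be a square-free integer. Then the embeddings $\phi:\mathbf H_3\to\mathfrak h_2$, $\phi:\mathbf{SL}(2,\mathbb C)\to\mathbf{Sp}(4,\mathbb R)$ and the involutions $\widehat{\ }$ on $\mathbf{Sp}(4,\mathbb R)$ and on $\mathfrak h_2$ are related as follows. (1) For any $g\in\mathbf{Sp}(4,\mathbb R)$ and $x\in\mathfrak h_2$ we have $\widehat{gx}=\widehat g\,\widehat x$. (2) The fixed point set of the involution $\widehat{\ }$ on $\mathbf{Sp}(4,\mathbb R)$ is $\phi(\mathbf{SL}(2,\mathbb C))$. (3) The fixed point set of the involution $\widehat{\ }$ on $\mathfrak h_2$ is $\phi(\mathbf H_3)$. (4) There is a unique (transitive) action of $\mathbf{SL}(2,\mathbb C)$ on $\mathbf H_3$ so that $\phi(gx)=\phi(g)\cdot\phi(x)$ for all $g\in\mathbf{SL}(2,\mathbb C)$ and all $x\in\mathbf H_3$.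
   Context: Transpose is written ${}^tA$. If $d\not\equiv1\pmod 4$ put $\beta=\begin{pmatrix}0&1\\ d&0\end{pmatrix}$, $\sigma=I_2$, $M=I_4$. If $d=4m+1$ put $\beta=\begin{pmatrix}1&2\\ 2m&-1\end{pmatrix}$, $\sigma=\begin{pmatrix}2&0\\ -1&1\end{pmatrix}$, $M=\begin{pmatrix}\sigma&0\\ 0&2\,{}^t\sigma^{-1}\end{pmatrix}$. Put $N_\beta=\begin{pmatrix}\beta&0\\ 0&{}^t\beta\end{pmatrix}$. $\mathbf{Sp}(4,\mathbb R)$ consists of real block matrices $\begin{pmatrix}A&B\\ C&D\end{pmatrix}$ with ${}^tAD-{}^tCB=I$ and ${}^tAC$, ${}^tBD$ symmetric, acting on the Siegel space $\mathfrak h_2$ (symmetric $2\times2$ complex $Z$ with $\mathrm{Im}\,Z>0$) by $(AZ+B)(CZ+D)^{-1}$. Involutions: $\widehat g=N_\beta gN_\beta^{-1}$ on $\mathbf{Sp}(4,\mathbb R)$ and $\widehat Z=\beta\overline Z\,{}^t\beta^{-1}$ on $\mathfrak h_2$. $\mathbf H_3=\{(z,r)\in\mathbb C\times\mathbb R:\mathrm{Im}(z)>0\}$ and $\phi(z,r)=\sigma\begin{pmatrix}z&r\\ r&d\bar z\end{pmatrix}{}^t\sigma\in\mathfrak h_2$. With $a_i,b_i\in\mathbb R$, $$\phi\begin{pmatrix}a_1+b_1\sqrt d&a_2+b_2\sqrt d\\ a_3+b_3\sqrt d&a_4+b_4\sqrt d\end{pmatrix}=M\begin{pmatrix}a_1&b_1&b_2&a_2\\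 b_1d&a_1&a_2&b_2d\\ b_3d&a_3&a_4&b_4d\\ a_3&b_3&b_4&a_4\end{pmatrix}M^{-1}\in\mathbf{Sp}(4,\mathbb R).$$ *)

theory Defs
  imports
    "HOL-Analysis.Analysis"
    "HOL-Algebra.Group_Action"
    "HOL-Computational_Algebra.Squarefree"
begin

definition mat2 :: "'a::zero \<Rightarrow> 'a \<Rightarrow> 'a \<Rightarrow> 'a \<Rightarrow> 'a^2^2" where
  "mat2 a b c e = vector [vector [a, b], vector [c, e]]"

text \<open>
  A 4-by-4 matrix is indexed by the four-element type \<open>2 + 2\<close>, so that its four 2-by-2 blocks
  are directly accessible: \<open>Inl\<close> addresses the first two rows or columns, \<open>Inr\<close> the last two.
\<close>

definition block :: "'a^2^2 \<Rightarrow> 'a^2^2 \<Rightarrow> 'a^2^2 \<Rightarrow> 'a^2^2 \<Rightarrow> 'a^(2+2)^(2+2)" where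
  "block A B C D = (\<chi> i j. case i of
      Inl k \<Rightarrow> (case j of Inl l \<Rightarrow> A $ k $ l | Inr l \<Rightarrow> B $ k $ l)
    | Inr k \<Rightarrow> (case j of Inl l \<Rightarrow> C $ k $ l | Inr l \<Rightarrow> D $ k $ l))"

definition blockA :: "'a^(2+2)^(2+2) \<Rightarrow> 'a^2^2" where
  "blockA g = (\<chi> i j. g $ Inl i $ Inl j)"

definition blockB :: "'a^(2+2)^(2+2) \<Rightarrow> 'a^2^2" where
  "blockB g = (\<chi> i j. g $ Inl i $ Inr j)"

definition blockC :: "'a^(2+2)^(2+2) \<Rightarrow> 'a^2^2" where
  "blockC g = (\<chi> i j. g $ Inr i $ Inl j)"

definition blockD :: "'a^(2+2)^(2+2) \<Rightarrow> 'a^2^2" where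
  "blockD g = (\<chi> i j. g $ Inr i $ Inr j)"

definition cmat :: "real^'n^'m \<Rightarrow> complex^'n^'m" where
  "cmat A = (\<chi> i j. complex_of_real (A $ i $ j))"

definition cnj_mat :: "complex^'n^'m \<Rightarrow> complex^'n^'m" where
  "cnj_mat Z = (\<chi> i j. cnj (Z $ i $ j))"

definition Im_mat :: "complex^'n^'m \<Rightarrow> real^'n^'m" where
  "Im_mat Z = (\<chi> i j. Im (Z $ i $ j))"

definition symmetric_mat :: "'a^'n^'n \<Rightarrow> bool" where
  "symmetric_mat A \<longleftrightarrow> transpose A = A"

definition pos_def_mat :: "real^'n^'n \<Rightarrow> bool" where
  "pos_def_mat A \<longleftrightarrow> symmetric_mat A \<and> (\<forall>v. v \<noteq> 0 \<longrightarrow> 0 < v \<bullet> (A *v v))"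

definition Sp4 :: "(real^(2+2)^(2+2)) set" where
  "Sp4 = {g. transpose (blockA g) ** blockD g - transpose (blockC g) ** blockB g = mat 1
           \<and> symmetric_mat (transpose (blockA g) ** blockC g)
           \<and> symmetric_mat (transpose (blockB g) ** blockD g)}"

definition siegel :: "(complex^2^2) set" where
  "siegel = {Z. symmetric_mat Z \<and> pos_def_mat (Im_mat Z)}"

definition Sp_act :: "real^(2+2)^(2+2) \<Rightarrow> complex^2^2 \<Rightarrow> complex^2^2" where
  "Sp_act g Z = (cmat (blockA g) ** Z + cmat (blockB g))
                ** matrix_inv (cmat (blockC g) ** Z + cmat (blockD g))"

text \<open>In the case \<open>d = 4 * m + 1\<close>, the integer \<open>m\<close> is \<open>d div 4\<close>, also for negative \<open>d\<close>.\<close>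

definition beta :: "int \<Rightarrow> real^2^2" where
  "beta d = (if d mod 4 = 1 then mat2 1 2 (2 * of_int (d div 4)) (- 1)
             else mat2 0 1 (of_int d) 0)"

definition sigma :: "int \<Rightarrow> real^2^2" where
  "sigma d = (if d mod 4 = 1 then mat2 2 0 (- 1) 1 else mat 1)"

definition M_mat :: "int \<Rightarrow> real^(2+2)^(2+2)" where
  "M_mat d = (if d mod 4 = 1
              then block (sigma d) 0 0 (2 *\<^sub>R matrix_inv (transpose (sigma d)))
              else mat 1)"

definition N_beta :: "int \<Rightarrow> real^(2+2)^(2+2)" where
  "N_beta d = block (beta d) 0 0 (transpose (beta d))"

definition hat_Sp :: "int \<Rightarrow> real^(2+2)^(2+2) \<Rightarrow> real^(2+2)^(2+2)" where
  "hat_Sp d g = N_beta d ** g ** matrix_inv (N_beta d)"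

definition hat_siegel :: "int \<Rightarrow> complex^2^2 \<Rightarrow> complex^2^2" where
  "hat_siegel d Z = cmat (beta d) ** cnj_mat Z ** matrix_inv (transpose (cmat (beta d)))"

definition H3 :: "(complex \<times> real) set" where
  "H3 = {(z, r). Im z > 0}"

definition phi_H :: "int \<Rightarrow> complex \<times> real \<Rightarrow> complex^2^2" where
  "phi_H d = (\<lambda>(z, r). cmat (sigma d)
       ** mat2 z (of_real r) (of_real r) (of_int d * cnj z) ** transpose (cmat (sigma d)))"

definition SL2C :: "(complex^2^2) monoid" where
  "SL2C = \<lparr>carrier = {g. det g = 1}, mult = (**), one = mat 1\<rparr>"

text \<open>
  For \<open>d < 0\<close> every complex number is uniquely \<open>a + b * csqrt d\<close> with real \<open>a\<close>, \<open>b\<close>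
  (lemma \<open>coords_unique\<close>); \<open>coord_a\<close> and \<open>coord_b\<close> extract these coordinates.
\<close>

definition coord_a :: "complex \<Rightarrow> real" where
  "coord_a w = Re w"

definition coord_b :: "int \<Rightarrow> complex \<Rightarrow> real" where
  "coord_b d w = Im w / sqrt (- of_int d)"

lemma coords_unique:
  assumes "d < 0"
  shows "w = of_real a + of_real b * csqrt (of_int d) \<longleftrightarrow> a = coord_a w \<and> b = coord_b d w"
proof -
  have "csqrt (of_int d) = csqrt (complex_of_real (of_int d))" by simp
  also have "\<dots> = \<i> * of_real (sqrt (- of_int d))"
    using assms by (subst csqrt_of_real_nonpos) auto
  finally show ?thesis
    using assms by (auto simp: complex_eq_iff coord_a_def coord_b_def field_simps)
qed

definition phi_SL :: "int \<Rightarrow> complex^2^2 \<Rightarrow> real^(2+2)^(2+2)" where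
  "phi_SL d g =
    (let a1 = coord_a (g $ 1 $ 1); b1 = coord_b d (g $ 1 $ 1);
         a2 = coord_a (g $ 1 $ 2); b2 = coord_b d (g $ 1 $ 2);
         a3 = coord_a (g $ 2 $ 1); b3 = coord_b d (g $ 2 $ 1);
         a4 = coord_a (g $ 2 $ 2); b4 = coord_b d (g $ 2 $ 2);
         \<delta> = real_of_int d
     in M_mat d
        ** block (mat2 a1 b1 (b1 * \<delta>) a1) (mat2 b2 a2 a2 (b2 * \<delta>))
                 (mat2 (b3 * \<delta>) a3 a3 b3) (mat2 a4 (b4 * \<delta>) b4 a4)
        ** matrix_inv (M_mat d))"

text \<open>
  An action is a curried map \<open>act\<close> with \<open>act g\<close> in the group of (extensional) bijections of
  \<open>H3\<close>.  Extensionality in \<open>g\<close> is required so that uniqueness only concerns the values on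
  \<open>SL2C\<close> and not the irrelevant values on matrices of other determinants.
\<close>

definition compatible_action :: "int \<Rightarrow> (complex^2^2 \<Rightarrow> complex \<times> real \<Rightarrow> complex \<times> real) \<Rightarrow> bool" where
  "compatible_action d act \<longleftrightarrow>
     act \<in> extensional (carrier SL2C) \<and> group_action SL2C H3 act \<and>
     (\<forall>g \<in> carrier SL2C. \<forall>x \<in> H3. phi_H d (act g x) = Sp_act (phi_SL d g) (phi_H d x))"

end

theory Submission
  imports Defs
begin

text \<open>
  Conjugation by \<open>sigma d\<close> turns \<open>beta d\<close> into the companion matrix \<open>beta0 d\<close> of \<open>x\<^sup>2 - d\<close>, and both
  fixed point sets become linear commutation conditions with \<open>beta0 d\<close> that are read off entrywise;
  the symplectic condition then says exactly that the complex determinant is 1, because \<open>M_mat d\<close> is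
  a symplectic similitude.  For \<open>P = A Z + B\<close> and \<open>Q = C Z + D\<close>, the identity
  \<open>P\<^sup>T cnj Q - Q\<^sup>T cnj P = Z - cnj Z\<close> and the positivity of \<open>Im Z\<close> show that \<open>Q\<close> is invertible and
  that the Siegel space is preserved.  Since the involutions are compatible with the action, the
  fixed points of one act on the fixed points of the other, which is the required action on \<open>H3\<close>.
\<close>

subsection \<open>Matrices and the symplectic form\<close>

lemma mat2_nth [simp]:
  "mat2 a b c e $ 1 $ 1 = a" "mat2 a b c e $ 1 $ 2 = b"
  "mat2 a b c e $ 2 $ 1 = c" "mat2 a b c e $ 2 $ 2 = e"
  by (simp_all add: mat2_def)

lemma mat_2_2_eq_iff:
  "A = (B :: 'a^2^2) \<longleftrightarrow> A$1$1 = B$1$1 \<and> A$1$2 = B$1$2 \<and> A$2$1 = B$2$1 \<and> A$2$2 = B$2$2"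
  by (auto simp: vec_eq_iff forall_2)

lemma transpose_nth [simp]: "transpose A $ i $ j = A $ j $ i"
  by (simp add: transpose_def)

lemma mat_nth: "mat k $ i $ j = (if i = j then k else 0)"
  by (simp add: mat_def)

lemma matrix_mult_2_nth: "((A :: 'a::semiring_1^2^'n) ** B) $ i $ j = A$i$1 * B$1$j + A$i$2 * B$2$j"
  by (simp add: matrix_matrix_mult_def sum_2)

lemma cmat_nth [simp]: "cmat A $ i $ j = of_real (A $ i $ j)"
  by (simp add: cmat_def)

lemma cnj_mat_nth [simp]: "cnj_mat Z $ i $ j = cnj (Z $ i $ j)"
  by (simp add: cnj_mat_def)

lemma Im_mat_nth [simp]: "Im_mat Z $ i $ j = Im (Z $ i $ j)"
  by (simp add: Im_mat_def)

lemma cmat_mult: "cmat (A ** B) = cmat A ** cmat B"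
  by (simp add: vec_eq_iff matrix_matrix_mult_def)

lemma cmat_add: "cmat (A + B) = cmat A + cmat B"
  by (simp add: vec_eq_iff)

lemma cmat_diff: "cmat (A - B) = cmat A - cmat B"
  by (simp add: vec_eq_iff)

lemma cmat_mat [simp]: "cmat (mat k) = mat (of_real k)"
  by (simp add: vec_eq_iff mat_nth)

lemma cmat_zero [simp]: "cmat 0 = 0"
  by (simp add: vec_eq_iff)

lemma transpose_cmat: "transpose (cmat A) = cmat (transpose A)"
  by (simp add: vec_eq_iff)

lemma cnj_mat_mult: "cnj_mat (A ** B) = cnj_mat A ** cnj_mat B"
  by (simp add: vec_eq_iff matrix_matrix_mult_def)

lemma cnj_mat_add: "cnj_mat (A + B) = cnj_mat A + cnj_mat B"
  by (simp add: vec_eq_iff)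

lemma cnj_mat_cmat [simp]: "cnj_mat (cmat A) = cmat A"
  by (simp add: vec_eq_iff)

lemma cnj_mat_zero [simp]: "cnj_mat 0 = 0"
  by (simp add: vec_eq_iff)

lemma cnj_mat_mat_1 [simp]: "cnj_mat (mat 1) = mat 1"
  by (simp add: vec_eq_iff mat_nth)

section \<open>Inverses of square matrices over a field\<close>

lemma matrix_inv_mult [simp]:
  fixes A :: "'a::field^'n^'n"
  assumes "invertible A"
  shows "A ** matrix_inv A = mat 1" "matrix_inv A ** A = mat 1"
  using someI_ex[OF assms[unfolded invertible_def]] by (auto simp: matrix_inv_def)

text \<open>The free left factor \<open>X\<close> lets the inverse cancel inside a longer product
  once \<open>matrix_mul_assoc\<close> has bracketed everything to the left.\<close>

lemma matrix_inv_cancel: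
  fixes A :: "'a::field^'n^'n"
  assumes "invertible A"
  shows "X ** A ** matrix_inv A = X" "X ** matrix_inv A ** A = X"
  by (simp_all add: assms flip: matrix_mul_assoc)

lemma matrix_inv_unique:
  fixes A :: "'a::field^'n^'n"
  assumes "A ** B = mat 1"
  shows "matrix_inv A = B" and "invertible A"
proof -
  show inv: "invertible A"
    using assms invertible_right_inverse by blast
  have "matrix_inv A ** (A ** B) = B"
    by (simp add: inv matrix_mul_assoc)
  then show "matrix_inv A = B"
    using assms by simp
qed

lemma invertible_matrix_inv:
  fixes A :: "'a::field^'n^'n"
  assumes "invertible A"
  shows "invertible (matrix_inv A)"
  using assms matrix_inv_unique(2) matrix_inv_mult(2) by blast

lemma matrix_inv_matrix_mult:
  fixes A B :: "'a::field^'n^'n"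
  assumes "invertible A" "invertible B"
  shows "matrix_inv (A ** B) = matrix_inv B ** matrix_inv A"
  by (rule matrix_inv_unique) (simp add: assms matrix_mul_assoc matrix_inv_cancel)

lemma matrix_inv_matrix_inv:
  fixes A :: "'a::field^'n^'n"
  assumes "invertible A"
  shows "matrix_inv (matrix_inv A) = A"
  by (rule matrix_inv_unique) (simp add: assms)

lemma matrix_inv_mat_1 [simp]: "matrix_inv (mat 1 :: 'a::field^'n^'n) = mat 1"
  by (rule matrix_inv_unique) simp

lemma transpose_matrix_inv:
  fixes A :: "'a::field^'n^'n"
  assumes "invertible A"
  shows "transpose (matrix_inv A) = matrix_inv (transpose A)"
  using assms
  by (intro matrix_inv_unique(1)[symmetric]) (simp flip: matrix_transpose_mul)

lemma cmat_matrix_inv: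
  fixes A :: "real^'n^'n"
  assumes "invertible A"
  shows "cmat (matrix_inv A) = matrix_inv (cmat A)"
  using assms by (intro matrix_inv_unique(1)[symmetric]) (simp flip: cmat_mult)

lemma invertible_cmat:
  fixes A :: "real^'n^'n"
  assumes "invertible A"
  shows "invertible (cmat A)"
  using assms by (intro matrix_inv_unique(2)[of _ "cmat (matrix_inv A)"]) (simp flip: cmat_mult)

lemma cnj_mat_matrix_inv:
  fixes A :: "complex^'n^'n"
  assumes "invertible A"
  shows "cnj_mat (matrix_inv A) = matrix_inv (cnj_mat A)"
  using assms by (intro matrix_inv_unique(1)[symmetric]) (simp flip: cnj_mat_mult)

lemma invertible_cnj_mat:
  fixes A :: "complex^'n^'n"
  assumes "invertible A"
  shows "invertible (cnj_mat A)"
  using assms by (intro matrix_inv_unique(2)[of _ "cnj_mat (matrix_inv A)"]) (simp flip: cnj_mat_mult)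

section \<open>Calculus of two-by-two blocks\<close>

lemma block_sel [simp]:
  "blockA (block A B C D) = A" "blockB (block A B C D) = B"
  "blockC (block A B C D) = C" "blockD (block A B C D) = D"
  by (simp_all add: vec_eq_iff blockA_def blockB_def blockC_def blockD_def block_def)

lemma block_collapse [simp]: "block (blockA g) (blockB g) (blockC g) (blockD g) = g"
  by (auto simp: vec_eq_iff blockA_def blockB_def blockC_def blockD_def block_def split: sum.split)

lemma block_eq_iff:
  "block A B C D = block A' B' C' D' \<longleftrightarrow> A = A' \<and> B = B' \<and> C = C' \<and> D = D'"
  by (metis block_sel)

lemma block_mult:
  fixes A :: "'a::semiring_1^2^2"
  shows "block A B C D ** block A' B' C' D' =
    block (A ** A' + B ** C') (A ** B' + B ** D') (C ** A' + D ** C') (C ** B' + D ** D')"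
proof -
  \<comment> \<open>A sum over the index type \<open>2 + 2\<close> splits into its
    \<open>Inl\<close> and \<open>Inr\<close> halves, which is exactly block multiplication.\<close>
  have "(\<Sum>k\<in>UNIV. f k) = (\<Sum>k\<in>UNIV. f (Inl k)) + (\<Sum>k\<in>UNIV. f (Inr k))" for f :: "2 + 2 \<Rightarrow> 'a"
    using sum.Plus[of "UNIV :: 2 set" "UNIV :: 2 set" f] by (simp add: comp_def)
  then show ?thesis
    by (auto simp: vec_eq_iff block_def matrix_matrix_mult_def split: sum.split)
qed

lemma transpose_block:
  "transpose (block A B C D) = block (transpose A) (transpose C) (transpose B) (transpose D)"
  by (auto simp: vec_eq_iff block_def split: sum.split)

lemma block_mat: "block (mat k) 0 0 (mat k) = mat k"
  by (auto simp: vec_eq_iff block_def mat_nth split: sum.split)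

lemma matrix_mult_zero_right [simp]: "A ** (0 :: 'a::semiring_1^'n^'m) = 0"
  by (simp add: vec_eq_iff matrix_matrix_mult_def)

lemma block_diag_inverse:
  fixes S T :: "'a::field^2^2"
  assumes "invertible S" "invertible T"
  shows "matrix_inv (block S 0 0 T) = block (matrix_inv S) 0 0 (matrix_inv T)"
    and "invertible (block S 0 0 T)"
proof -
  have "block S 0 0 T ** block (matrix_inv S) 0 0 (matrix_inv T) = mat 1"
    by (simp add: block_mult assms block_mat)
  from matrix_inv_unique[OF this] show
    "matrix_inv (block S 0 0 T) = block (matrix_inv S) 0 0 (matrix_inv T)" "invertible (block S 0 0 T)"
    by simp_all
qed

lemma block_diag_conj:
  fixes S T :: "'a::field^2^2"
  assumes "invertible S" "invertible T"
  shows "block S 0 0 T ** g ** matrix_inv (block S 0 0 T) =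
    block (S ** blockA g ** matrix_inv S) (S ** blockB g ** matrix_inv T)
          (T ** blockC g ** matrix_inv S) (T ** blockD g ** matrix_inv T)"
  by (subst block_collapse[of g, symmetric], simp only: block_diag_inverse(1)[OF assms] block_mult)
    simp

lemma matrix_mult_add_distrib:
  fixes A B :: "'a::semiring_1^'n^'m"
  shows "(A + B) ** C = A ** C + B ** C" "D ** (A + B) = D ** A + D ** B"
  by (simp_all add: vec_eq_iff matrix_matrix_mult_def ring_distribs sum.distrib)

lemma matrix_mult_diff_distrib:
  fixes A B :: "'a::ring_1^'n^'m"
  shows "(A - B) ** C = A ** C - B ** C" "D ** (A - B) = D ** A - D ** B"
  by (simp_all add: vec_eq_iff matrix_matrix_mult_def ring_distribs sum_subtractf)

lemma transpose_zero [simp]: "transpose 0 = 0"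
  by (simp add: vec_eq_iff)

lemma transpose_add: "transpose (A + B) = transpose A + transpose B"
  by (simp add: vec_eq_iff)

lemma transpose_diff: "transpose (A - B) = transpose A - transpose B"
  by (simp add: vec_eq_iff)

section \<open>The standard alternating form and its similitudes\<close>

definition symplectic_form :: "real^(2+2)^(2+2)" where
  "symplectic_form = block 0 (mat 1) (- mat 1) 0"

lemma neg_matrix_mult [simp]:
  fixes A :: "'a::ring_1^'n^'m"
  shows "(- A) ** B = - (A ** B)" "C ** (- A) = - (C ** A)"
  by (simp_all add: vec_eq_iff matrix_matrix_mult_def sum_negf)

text \<open>The diagonal blocks of the matrix equation are the two symmetry conditions. The
  off-diagonal blocks are negative transposes of each other, so they amount to the single condition
  on \<open>A\<close> and \<open>D\<close>.\<close>

lemma Sp4_iff_form: "g \<in> Sp4 \<longleftrightarrow> transpose g ** symplectic_form ** g = symplectic_form"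
proof -
  define A B C D where "A = blockA g" "B = blockB g" "C = blockC g" "D = blockD g"
  have g: "g = block A B C D"
    by (simp add: A_B_C_D_def)
  have "transpose g ** symplectic_form ** g =
     block (transpose A ** C - transpose C ** A) (transpose A ** D - transpose C ** B)
           (transpose B ** C - transpose D ** A) (transpose B ** D - transpose D ** B)"
    by (simp add: g transpose_block symplectic_form_def block_mult)
  moreover have "transpose B ** C - transpose D ** A = - transpose (transpose A ** D - transpose C ** B)"
    by (simp add: transpose_diff matrix_transpose_mul)
  moreover have "- X = - mat 1 \<longleftrightarrow> X = mat 1" for X :: "real^2^2"
    by simp
  ultimately show ?thesis
    by (auto simp: Sp4_def g symplectic_form_def block_eq_iff symmetric_mat_def matrix_transpose_mul)
qed

text \<open>The scalar \<open>k\<close> that \<open>M\<close> contributes is carried through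
  \<open>g\<close> and then absorbed again by reading \<open>k\<close> times the form as
  \<open>transpose M ** symplectic_form ** M\<close>. Thus \<open>M\<close> itself may lie outside
  \<open>Sp4\<close>.\<close>

lemma Sp4_similitude_conj:
  assumes M: "invertible M" "transpose M ** symplectic_form ** M = k *\<^sub>R symplectic_form"
    and g: "g \<in> Sp4"
  shows "M ** g ** matrix_inv M \<in> Sp4"
proof -
  let ?J = symplectic_form and ?M' = "matrix_inv M"
  have "transpose (M ** g ** ?M') ** ?J ** (M ** g ** ?M')
      = transpose ?M' ** transpose g ** (transpose M ** ?J ** M) ** g ** ?M'"
    by (simp add: matrix_transpose_mul matrix_mul_assoc)
  also have "\<dots> = k *\<^sub>R (transpose ?M' ** (transpose g ** ?J ** g) ** ?M')"
    by (simp add: M matrix_mul_assoc matrix_scalar_ac flip: scalar_matrix_assoc)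
  also have "\<dots> = transpose ?M' ** (k *\<^sub>R ?J) ** ?M'"
    using g by (simp add: Sp4_iff_form matrix_scalar_ac flip: scalar_matrix_assoc)
  also have "\<dots> = (transpose ?M' ** transpose M) ** ?J ** (M ** ?M')"
    by (simp only: M(2)[symmetric] matrix_mul_assoc)
  also have "\<dots> = ?J"
    using M(1) by (simp flip: matrix_transpose_mul)
  finally show ?thesis
    by (simp add: Sp4_iff_form)
qed

subsection \<open>The action on the Siegel space\<close>

text \<open>Source of everything about the Siegel space: \<open>W = Z\<close> yields symmetry of the
  image point, \<open>W = cnj_mat Z\<close> yields invertibility of the denominator and
  positivity.\<close>

lemma symplectic_cocycle_identity:
  fixes A B C D Z W :: "'a::comm_ring_1^'n^'n"
  assumes AC: "transpose A ** C = transpose C ** A" and BD: "transpose B ** D = transpose D ** B"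
    and AD: "transpose A ** D - transpose C ** B = mat 1" and Z: "transpose Z = Z"
  shows "transpose (A ** Z + B) ** (C ** W + D) - transpose (C ** Z + D) ** (A ** W + B) = Z - W"
proof -
  have AD': "transpose D ** A - transpose B ** C = mat 1"
    using arg_cong[OF AD, of transpose] by (simp add: transpose_diff matrix_transpose_mul)
  \<comment> \<open>Sorting the expansion by the outer factors \<open>Z\<close> and \<open>W\<close>
    leaves the block relations as coefficients: 0, 1, 1 and 0.\<close>
  have "transpose (A ** Z + B) ** (C ** W + D) - transpose (C ** Z + D) ** (A ** W + B)
     = Z ** (transpose A ** C - transpose C ** A) ** W + Z ** (transpose A ** D - transpose C ** B)
       - (transpose D ** A - transpose B ** C) ** W + (transpose B ** D - transpose D ** B)"
    by (simp add: transpose_add matrix_transpose_mul Z matrix_mult_add_distrib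
        matrix_mult_diff_distrib matrix_mul_assoc)
  then show ?thesis
    by (simp add: AC BD AD AD')
qed

text \<open>\<open>Z - cnj_mat Z\<close> is \<open>2 * \<i>\<close> times the imaginary part of
  \<open>Z\<close>, and for \<open>V = x + \<i> y\<close> the mixed terms in \<open>x\<close> and
  \<open>y\<close> only enter the real part. Vectors are one-column matrices so that associativity,
  transposition and conjugation of matrix products apply to them.\<close>

lemma Im_hermitian_form:
  fixes Z :: "complex^'n^'n" and V :: "complex^1^'n"
  defines "x \<equiv> \<chi> i. Re (V $ i $ 1)" and "y \<equiv> \<chi> i. Im (V $ i $ 1)"
  shows "Im ((transpose V ** (Z - cnj_mat Z) ** cnj_mat V) $ 1 $ 1) =
    2 * (x \<bullet> (Im_mat Z *v x) + y \<bullet> (Im_mat Z *v y))"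
proof -
  have "Im ((transpose V ** (Z - cnj_mat Z) ** cnj_mat V) $ 1 $ 1) =
    (\<Sum>j\<in>UNIV. \<Sum>i\<in>UNIV. 2 * (x$i * (Im (Z$i$j) * x$j) + y$i * (Im (Z$i$j) * y$j)))"
    by (simp add: matrix_matrix_mult_def sum_distrib_right Im_sum x_def y_def)
      (intro sum.cong refl, simp add: algebra_simps)
  also have "\<dots> = 2 * (x \<bullet> (Im_mat Z *v x) + y \<bullet> (Im_mat Z *v y))"
    by (subst sum.swap) (simp add: inner_vec_def matrix_vector_mult_def sum_distrib_left sum.distrib
        distrib_left)
  finally show ?thesis .
qed

lemma Im_hermitian_form_pos:
  fixes Z :: "complex^'n^'n" and V :: "complex^1^'n"
  assumes "pos_def_mat (Im_mat Z)" "V \<noteq> 0"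
  shows "0 < Im ((transpose V ** (Z - cnj_mat Z) ** cnj_mat V) $ 1 $ 1)"
proof -
  define x y where "x = (\<chi> i. Re (V $ i $ 1))" and "y = (\<chi> i. Im (V $ i $ 1))"
  have pos: "0 \<le> v \<bullet> (Im_mat Z *v v)" "v \<noteq> 0 \<Longrightarrow> 0 < v \<bullet> (Im_mat Z *v v)" for v
    using assms(1) by (cases "v = 0"; force simp: pos_def_mat_def)+
  have "x \<noteq> 0 \<or> y \<noteq> 0"
  proof (rule ccontr)
    assume "\<not> (x \<noteq> 0 \<or> y \<noteq> 0)"
    then have "V $ i $ 1 = 0" for i
      by (auto simp: x_def y_def vec_eq_iff complex_eq_iff)
    then have "V = 0"
      by (simp add: vec_eq_iff forall_1)
    with assms(2) show False ..
  qed
  then have "0 < x \<bullet> (Im_mat Z *v x) + y \<bullet> (Im_mat Z *v y)"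
    using pos[of x] pos[of y] by linarith
  then show ?thesis
    by (simp add: Im_hermitian_form x_def y_def)
qed

lemma Sp4_block_relations:
  assumes "g \<in> Sp4"
  shows "transpose (cmat (blockA g)) ** cmat (blockC g) = transpose (cmat (blockC g)) ** cmat (blockA g)"
    and "transpose (cmat (blockB g)) ** cmat (blockD g) = transpose (cmat (blockD g)) ** cmat (blockB g)"
    and "transpose (cmat (blockA g)) ** cmat (blockD g) - transpose (cmat (blockC g)) ** cmat (blockB g) = mat 1"
  using assms
  by (auto simp: Sp4_def symmetric_mat_def transpose_cmat matrix_transpose_mul
      simp flip: cmat_mult cmat_diff)

text \<open>A kernel vector of the denominator \<open>Q\<close> would annihilate both terms of the
  cocycle identity, and so be a nonzero vector on which the positive hermitian form of
  \<open>Z\<close> vanishes.\<close>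

lemma Sp4_cocycle_invertible:
  assumes "g \<in> Sp4" "Z \<in> siegel"
  shows "invertible (cmat (blockC g) ** Z + cmat (blockD g))"
proof (rule ccontr)
  define P Q where "P = cmat (blockA g) ** Z + cmat (blockB g)"
    and "Q = cmat (blockC g) ** Z + cmat (blockD g)"
  assume "\<not> invertible (cmat (blockC g) ** Z + cmat (blockD g))"
  then have "\<not> (\<exists>B. B ** Q = mat 1)"
    using invertible_left_inverse Q_def by blast
  then obtain v where v: "Q *v v = 0" "v \<noteq> 0"
    using matrix_left_invertible_ker by blast
  define V :: "complex^1^2" where "V = (\<chi> i j. v $ i)"
  have QV: "Q ** V = 0"
    using v(1) by (simp add: V_def vec_eq_iff matrix_matrix_mult_def matrix_vector_mult_def)
  have "V \<noteq> 0"
    using v(2) by (simp add: V_def vec_eq_iff)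
  have "transpose P ** cnj_mat Q - transpose Q ** cnj_mat P = Z - cnj_mat Z"
    using symplectic_cocycle_identity[OF Sp4_block_relations[OF assms(1)], of Z "cnj_mat Z"] assms(2)
    by (simp add: P_def Q_def siegel_def symmetric_mat_def cnj_mat_add cnj_mat_mult)
  then have "transpose V ** (Z - cnj_mat Z) ** cnj_mat V =
    transpose (P ** V) ** cnj_mat (Q ** V) - transpose (Q ** V) ** cnj_mat (P ** V)"
    by (simp add: matrix_transpose_mul cnj_mat_mult matrix_mul_assoc matrix_mult_diff_distrib
        flip: \<open>_ = Z - cnj_mat Z\<close>)
  also have "\<dots> = 0"
    by (simp add: QV)
  finally show False
    using Im_hermitian_form_pos[OF _ \<open>V \<noteq> 0\<close>, of Z] assms(2) by (simp add: siegel_def)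
qed

lemma Sp_act_siegel:
  assumes "g \<in> Sp4" "Z \<in> siegel"
  shows "Sp_act g Z \<in> siegel"
proof -
  define P Q where "P = cmat (blockA g) ** Z + cmat (blockB g)"
    and "Q = cmat (blockC g) ** Z + cmat (blockD g)"
  define R where "R = matrix_inv Q"
  define W where "W = Sp_act g Z"
  have inv: "invertible Q"
    using Sp4_cocycle_invertible[OF assms] by (simp add: Q_def)
  have QR: "Q ** R = mat 1" "transpose R ** transpose Q = mat 1" "cnj_mat Q ** cnj_mat R = mat 1"
    by (simp_all add: R_def inv flip: matrix_transpose_mul cnj_mat_mult)
  have QR': "X ** Q ** R = X" "X ** cnj_mat Q ** cnj_mat R = X" for X :: "complex^2^2"
    by (simp_all add: QR flip: matrix_mul_assoc)
  have W: "W = P ** R"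
    by (simp add: W_def Sp_act_def P_def Q_def R_def)
  have Zsym: "transpose Z = Z"
    using assms(2) by (simp add: siegel_def symmetric_mat_def)
  note id = symplectic_cocycle_identity[OF Sp4_block_relations[OF assms(1)] Zsym]
  have "transpose P ** Q - transpose Q ** P = 0"
    using id[of Z] by (simp add: P_def Q_def)
  \<comment> \<open>Since \<open>W = P ** R\<close> and \<open>Q ** R = mat 1\<close>, multiplying
    by \<open>R\<close> on both sides turns the identity into
    \<open>transpose W - W = 0\<close>.\<close>
  then have "transpose R ** (transpose P ** Q - transpose Q ** P) ** R = 0"
    by simp
  then have W_sym: "transpose W = W"
    by (simp add: matrix_mult_diff_distrib matrix_mul_assoc QR QR' W matrix_transpose_mul)
  have "transpose P ** cnj_mat Q - transpose Q ** cnj_mat P = Z - cnj_mat Z"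
    using id[of "cnj_mat Z"] by (simp add: P_def Q_def cnj_mat_add cnj_mat_mult)
  then have "transpose R ** (Z - cnj_mat Z) ** cnj_mat R =
      transpose R ** (transpose P ** cnj_mat Q - transpose Q ** cnj_mat P) ** cnj_mat R"
    by simp
  also have "\<dots> = transpose W - cnj_mat W"
    by (simp add: matrix_mult_diff_distrib matrix_mul_assoc QR QR' W matrix_transpose_mul cnj_mat_mult)
  finally have W_diff: "transpose R ** (Z - cnj_mat Z) ** cnj_mat R = W - cnj_mat W"
    by (simp add: W_sym)
  have "0 < x \<bullet> (Im_mat W *v x)" if "x \<noteq> 0" for x
  proof -
    \<comment> \<open>The form of \<open>W\<close> at the real vector \<open>x\<close> equals the
      form of \<open>Z\<close> at \<open>R ** X\<close>, which is nonzero because \<open>R\<close>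
      is invertible.\<close>
    define X :: "complex^1^2" where "X = (\<chi> i j. of_real (x $ i))"
    have "R ** X \<noteq> 0"
    proof
      assume "R ** X = 0"
      then have "Q ** R ** X = 0"
        by (simp flip: matrix_mul_assoc)
      then show False
        using that by (simp add: QR X_def vec_eq_iff)
    qed
    then have "0 < Im ((transpose (R ** X) ** (Z - cnj_mat Z) ** cnj_mat (R ** X)) $ 1 $ 1)"
      using assms(2) by (intro Im_hermitian_form_pos) (simp_all add: siegel_def)
    also have "transpose (R ** X) ** (Z - cnj_mat Z) ** cnj_mat (R ** X) =
        transpose X ** (W - cnj_mat W) ** cnj_mat X"
      by (simp add: matrix_transpose_mul cnj_mat_mult matrix_mul_assoc flip: W_diff)
    also have "Im (\<dots> $ 1 $ 1) = 2 * (x \<bullet> (Im_mat W *v x))"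
      by (simp add: Im_hermitian_form X_def vec_lambda_eta flip: zero_vec_def)
    finally show ?thesis
      by simp
  qed
  moreover have "Im_mat W $ i $ j = Im_mat W $ j $ i" for i j
    using W_sym by (metis Im_mat_nth transpose_nth)
  ultimately have "pos_def_mat (Im_mat W)"
    by (auto simp: pos_def_mat_def symmetric_mat_def vec_eq_iff)
  then show ?thesis
    using W_sym by (simp add: siegel_def symmetric_mat_def W_def)
qed

section \<open>Composition and conjugation of fractional linear maps\<close>

text \<open>Numerator and denominator of \<open>g ** h\<close> at \<open>Z\<close> are those of
  \<open>g\<close> at \<open>Sp_act h Z\<close>, both multiplied on the right by the denominator
  \<open>Q\<close> of \<open>h\<close>, which then cancels.\<close>

lemma Sp_act_mult:
  assumes h: "invertible (cmat (blockC h) ** Z + cmat (blockD h))"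
    and g: "invertible (cmat (blockC g) ** Sp_act h Z + cmat (blockD g))"
  shows "Sp_act (g ** h) Z = Sp_act g (Sp_act h Z)"
proof -
  define Q where "Q = cmat (blockC h) ** Z + cmat (blockD h)"
  have actQ: "X ** Sp_act h Z ** Q = X ** (cmat (blockA h) ** Z + cmat (blockB h))" for X :: "complex^2^2"
    using h by (simp add: Sp_act_def Q_def matrix_mul_assoc matrix_inv_cancel)
  have gh: "blockA (g ** h) = blockA g ** blockA h + blockB g ** blockC h"
    "blockB (g ** h) = blockA g ** blockB h + blockB g ** blockD h"
    "blockC (g ** h) = blockC g ** blockA h + blockD g ** blockC h"
    "blockD (g ** h) = blockC g ** blockB h + blockD g ** blockD h"
    by (metis block_collapse block_mult block_sel)+
  have "cmat (blockA (g ** h)) ** Z + cmat (blockB (g ** h))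
      = (cmat (blockA g) ** Sp_act h Z + cmat (blockB g)) ** Q"
    "cmat (blockC (g ** h)) ** Z + cmat (blockD (g ** h))
      = (cmat (blockC g) ** Sp_act h Z + cmat (blockD g)) ** Q"
    by (simp_all add: gh matrix_mult_add_distrib actQ)
      (simp_all add: Q_def cmat_mult cmat_add matrix_mult_add_distrib matrix_mul_assoc)
  then show ?thesis
    using h unfolding Sp_act_def[of g] Sp_act_def[of "g ** h"]
    by (simp add: Q_def[symmetric] g matrix_inv_matrix_mult matrix_mul_assoc matrix_inv_cancel)
qed

text \<open>The block diagonal matrix of \<open>S\<close> and \<open>T\<close> maps \<open>Z\<close>
  to \<open>S Z\<close> times the inverse of \<open>T\<close>. Stated for arbitrary invertible
  \<open>S\<close> and \<open>T\<close>, this covers both \<open>N_beta d\<close> and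
  \<open>M_mat d\<close>, which are in general only similitudes.\<close>

lemma Sp_act_block_diag_conj:
  assumes S: "invertible S" and T: "invertible T"
    and Q: "invertible (cmat (blockC g) ** Z + cmat (blockD g))"
  shows "Sp_act (block S 0 0 T ** g ** matrix_inv (block S 0 0 T))
      (cmat S ** Z ** matrix_inv (cmat T)) = cmat S ** Sp_act g Z ** matrix_inv (cmat T)"
proof -
  note inv = matrix_inv_cancel[OF invertible_cmat[OF S]]
  have "cmat S ** cmat (blockA g) ** matrix_inv (cmat S) ** (cmat S ** Z ** matrix_inv (cmat T))
      + cmat S ** cmat (blockB g) ** matrix_inv (cmat T)
      = cmat S ** (cmat (blockA g) ** Z + cmat (blockB g)) ** matrix_inv (cmat T)"
    by (simp add: matrix_mult_add_distrib matrix_mul_assoc inv)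
  moreover have "cmat T ** cmat (blockC g) ** matrix_inv (cmat S) ** (cmat S ** Z ** matrix_inv (cmat T))
      + cmat T ** cmat (blockD g) ** matrix_inv (cmat T)
      = cmat T ** (cmat (blockC g) ** Z + cmat (blockD g)) ** matrix_inv (cmat T)"
    by (simp add: matrix_mult_add_distrib matrix_mul_assoc inv)
  moreover have "matrix_inv (cmat T ** (cmat (blockC g) ** Z + cmat (blockD g)) ** matrix_inv (cmat T))
    = cmat T ** matrix_inv (cmat (blockC g) ** Z + cmat (blockD g)) ** matrix_inv (cmat T)"
    using Q invertible_cmat[OF T]
    by (simp add: matrix_inv_matrix_mult invertible_mult invertible_matrix_inv matrix_inv_matrix_inv
        matrix_mul_assoc)
  ultimately show ?thesis
    by (simp add: block_diag_conj S T Sp_act_def cmat_mult cmat_matrix_inv matrix_mul_assoc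
        matrix_inv_cancel[OF invertible_cmat[OF T]])
qed

subsection \<open>Fixed points of the involutions\<close>

lemma matrix_mult_inv_eq_iff:
  fixes A :: "'a::field^'n^'n"
  assumes "invertible A"
  shows "X ** matrix_inv A = Y \<longleftrightarrow> X = Y ** A"
  using matrix_inv_cancel[OF assms] by metis

lemma matrix_mult_cancel:
  fixes A B :: "'a::field^'n^'n"
  assumes "invertible A" "invertible B"
  shows "A ** X ** B = A ** Y ** B \<longleftrightarrow> X = Y"
proof
  assume "A ** X ** B = A ** Y ** B"
  then have "matrix_inv A ** (A ** X ** B) ** matrix_inv B = matrix_inv A ** (A ** Y ** B) ** matrix_inv B"
    by simp
  then show "X = Y"
    using assms by (simp add: matrix_mul_assoc matrix_inv_cancel)
qed simp

lemma symplectic_form_similitude_inv: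
  assumes M: "invertible M" "transpose M ** symplectic_form ** M = k *\<^sub>R symplectic_form"
    and "k \<noteq> 0"
  shows "transpose (matrix_inv M) ** symplectic_form ** matrix_inv M = (1 / k) *\<^sub>R symplectic_form"
proof -
  have "transpose (matrix_inv M) ** transpose M = mat 1"
    using M(1) by (simp flip: matrix_transpose_mul)
  then have "symplectic_form = transpose (matrix_inv M) ** (transpose M ** symplectic_form ** M) ** matrix_inv M"
    using M(1) by (simp add: matrix_mul_assoc matrix_inv_cancel)
  also have "\<dots> = k *\<^sub>R (transpose (matrix_inv M) ** symplectic_form ** matrix_inv M)"
    by (simp add: M(2) matrix_scalar_ac flip: scalar_matrix_assoc)
  finally have "(1 / k) *\<^sub>R symplectic_form =
      (1 / k) *\<^sub>R (k *\<^sub>R (transpose (matrix_inv M) ** symplectic_form ** matrix_inv M))"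
    by (rule arg_cong)
  then show ?thesis
    using \<open>k \<noteq> 0\<close> by simp
qed

text \<open>The quadratic form of the new imaginary part at \<open>v\<close> is the old one at
  \<open>transpose S *v v\<close>.\<close>

lemma siegel_conj:
  assumes Z: "Z \<in> siegel" and S: "invertible S"
  shows "cmat S ** Z ** transpose (cmat S) \<in> siegel"
proof -
  have "Im_mat (cmat S ** Z ** transpose (cmat S)) = S ** Im_mat Z ** transpose S"
    by (simp add: vec_eq_iff matrix_matrix_mult_def Im_sum)
  moreover have "pos_def_mat (S ** Im_mat Z ** transpose S)"
    unfolding pos_def_mat_def
  proof (intro conjI allI impI)
    show "symmetric_mat (S ** Im_mat Z ** transpose S)"
      using Z by (simp add: siegel_def pos_def_mat_def symmetric_mat_def matrix_transpose_mul matrix_mul_assoc)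
    fix v :: "real^2"
    assume "v \<noteq> 0"
    have "transpose (matrix_inv S) ** transpose S = mat 1"
      using S by (simp flip: matrix_transpose_mul)
    then have "transpose (matrix_inv S) *v (transpose S *v v) = v"
      by (simp only: matrix_vector_mul_assoc matrix_vector_mul_lid)
    then have "transpose S *v v \<noteq> 0"
      using \<open>v \<noteq> 0\<close> by auto
    then have "0 < (transpose S *v v) \<bullet> (Im_mat Z *v (transpose S *v v))"
      using Z unfolding siegel_def pos_def_mat_def by blast
    also have "\<dots> = v \<bullet> ((S ** Im_mat Z ** transpose S) *v v)"
      by (metis dot_lmul_matrix matrix_vector_mul_assoc transpose_matrix_vector)
    finally show "0 < v \<bullet> ((S ** Im_mat Z ** transpose S) *v v)" .
  qed
  ultimately show ?thesis
    using Z by (simp add: siegel_def symmetric_mat_def matrix_transpose_mul matrix_mul_assoc)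
qed

section \<open>Reduction to the companion form\<close>

text \<open>This is \<open>beta d\<close> outside the case \<open>d mod 4 = 1\<close>, used here for
  all \<open>d\<close>. Likewise \<open>phi_H0\<close> and \<open>phi_SL0\<close> are the embeddings
  before \<open>sigma d\<close> and \<open>M_mat d\<close> are applied.\<close>

definition beta0 :: "int \<Rightarrow> real^2^2" where
  "beta0 d = mat2 0 1 (of_int d) 0"

definition phi_H0 :: "int \<Rightarrow> complex \<times> real \<Rightarrow> complex^2^2" where
  "phi_H0 d = (\<lambda>(z, r). mat2 z (of_real r) (of_real r) (of_int d * cnj z))"

text \<open>Up to conjugation by the block diagonal matrix of \<open>mat 1\<close> and the swap
  \<open>mat2 0 1 1 0\<close>, this is restriction of scalars: each entry
  \<open>a + b sqrt d\<close> is replaced by the real matrix \<open>a + b beta0\<close>. The swap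
  also conjugates \<open>beta0 d\<close> into its transpose.\<close>

definition phi_SL0 :: "int \<Rightarrow> complex^2^2 \<Rightarrow> real^(2+2)^(2+2)" where
  "phi_SL0 d g =
    (let a1 = coord_a (g $ 1 $ 1); b1 = coord_b d (g $ 1 $ 1);
         a2 = coord_a (g $ 1 $ 2); b2 = coord_b d (g $ 1 $ 2);
         a3 = coord_a (g $ 2 $ 1); b3 = coord_b d (g $ 2 $ 1);
         a4 = coord_a (g $ 2 $ 2); b4 = coord_b d (g $ 2 $ 2);
         \<delta> = real_of_int d
     in block (mat2 a1 b1 (b1 * \<delta>) a1) (mat2 b2 a2 a2 (b2 * \<delta>))
              (mat2 (b3 * \<delta>) a3 a3 b3) (mat2 a4 (b4 * \<delta>) b4 a4))"

text \<open>The multiplier of the similitude \<open>M_mat d\<close>. It allows one block formula for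
  \<open>M_mat d\<close> in both residue cases.\<close>

definition M_factor :: "int \<Rightarrow> real" where
  "M_factor d = (if d mod 4 = 1 then 2 else 1)"

lemma M_factor_pos: "M_factor d > 0"
  by (simp add: M_factor_def)

lemma phi_H_eq: "phi_H d x = cmat (sigma d) ** phi_H0 d x ** transpose (cmat (sigma d))"
  by (simp add: phi_H_def phi_H0_def split: prod.split)

lemma phi_SL_eq: "phi_SL d g = M_mat d ** phi_SL0 d g ** matrix_inv (M_mat d)"
  by (simp add: phi_SL_def phi_SL0_def Let_def)

lemma invertible_sigma: "invertible (sigma d)"
proof (cases "d mod 4 = 1")
  case True
  \<comment> \<open>The second factor is the explicit inverse of \<open>sigma d\<close>.\<close>
  have "mat2 2 0 (- 1) 1 ** mat2 (1/2) 0 (1/2) 1 = (mat 1 :: real^2^2)"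
    by (simp add: mat_2_2_eq_iff matrix_mult_2_nth mat_nth)
  then show ?thesis
    using True matrix_inv_unique(2) by (simp add: sigma_def)
qed (simp add: sigma_def matrix_inv_unique(2)[of _ "mat 1"])

lemma invertible_transpose_sigma: "invertible (transpose (sigma d))"
  using invertible_sigma by (rule transpose_invertible)

lemma M_mat_eq: "M_mat d = block (sigma d) 0 0 (M_factor d *\<^sub>R matrix_inv (transpose (sigma d)))"
  by (simp add: M_mat_def M_factor_def sigma_def block_mat)

lemma invertible_M_block: "invertible (M_factor d *\<^sub>R matrix_inv (transpose (sigma d)))"
  using M_factor_pos[of d]
  by (intro scalar_invertible invertible_matrix_inv invertible_transpose_sigma) simp

lemma invertible_M_mat: "invertible (M_mat d)"
  unfolding M_mat_eq by (intro block_diag_inverse invertible_sigma invertible_M_block)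

lemma M_mat_similitude:
  "transpose (M_mat d) ** symplectic_form ** M_mat d = M_factor d *\<^sub>R symplectic_form"
proof -
  have "k *\<^sub>R block A B C D = block (k *\<^sub>R A) (k *\<^sub>R B) (k *\<^sub>R C) (k *\<^sub>R D)" for k and A B C D :: "real^2^2"
    by (auto simp: vec_eq_iff block_def split: sum.split)
  moreover have "matrix_inv (sigma d) ** sigma d = mat 1"
    "transpose (sigma d) ** matrix_inv (transpose (sigma d)) = mat 1"
    using invertible_sigma invertible_transpose_sigma by simp_all
  moreover have "transpose (matrix_inv (transpose (sigma d))) = matrix_inv (sigma d)"
    by (simp add: transpose_matrix_inv invertible_transpose_sigma)
  ultimately show ?thesis
    by (simp add: M_mat_eq transpose_block symplectic_form_def block_mult transpose_scalar
        matrix_scalar_ac flip: scalar_matrix_assoc)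
qed

text \<open>In the nontrivial case only the lower left entry needs an argument: it compares
  \<open>4 * (d div 4) + 1\<close> with \<open>d\<close>.\<close>

lemma beta_sigma: "beta d ** sigma d = sigma d ** beta0 d"
proof (cases "d mod 4 = 1")
  case True
  then have "real_of_int d = 4 * real_of_int (d div 4) + 1"
    by (metis div_mod_decomp_int mult.commute of_int_1 of_int_add of_int_mult of_int_numeral)
  with True show ?thesis
    by (simp add: beta_def beta0_def sigma_def mat_2_2_eq_iff matrix_mult_2_nth)
qed (simp add: beta_def sigma_def beta0_def)

lemma invertible_beta:
  assumes "d \<noteq> 0"
  shows "invertible (beta d)"
proof -
  \<comment> \<open>The square of \<open>beta0 d\<close> is the scalar \<open>d\<close>, so its
    inverse is \<open>beta0 d\<close> divided by \<open>d\<close>.\<close>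
  have "beta0 d ** mat2 0 (1 / of_int d) 1 0 = mat 1"
    using assms by (simp add: beta0_def mat_2_2_eq_iff matrix_mult_2_nth mat_nth)
  then have "invertible (beta0 d)"
    by (rule matrix_inv_unique)
  moreover have "beta d = sigma d ** beta0 d ** matrix_inv (sigma d)"
    by (simp add: matrix_inv_cancel invertible_sigma flip: beta_sigma)
  ultimately show ?thesis
    by (simp add: invertible_mult invertible_matrix_inv invertible_sigma)
qed

lemma invertible_N_beta:
  assumes "d \<noteq> 0"
  shows "invertible (N_beta d)"
  unfolding N_beta_def
  by (intro block_diag_inverse transpose_invertible invertible_beta assms)

text \<open>The upper block is \<open>beta_sigma\<close>. The lower block is the same relation with
  \<open>sigma d\<close> moved to the other side and transposed.\<close>

lemma N_beta_M_mat: "N_beta d ** M_mat d = M_mat d ** block (beta0 d) 0 0 (transpose (beta0 d))"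
proof -
  let ?s = "sigma d"
  have "matrix_inv ?s ** (beta d ** ?s) ** matrix_inv ?s = matrix_inv ?s ** (?s ** beta0 d) ** matrix_inv ?s"
    by (simp add: beta_sigma)
  then have "matrix_inv ?s ** beta d = beta0 d ** matrix_inv ?s"
    by (simp add: matrix_mul_assoc matrix_inv_cancel invertible_sigma)
  from arg_cong[OF this, of transpose]
  have "transpose (beta d) ** matrix_inv (transpose ?s) = matrix_inv (transpose ?s) ** transpose (beta0 d)"
    by (simp add: matrix_transpose_mul transpose_matrix_inv invertible_sigma)
  then show ?thesis
    by (simp add: N_beta_def M_mat_eq block_mult beta_sigma matrix_scalar_ac flip: scalar_matrix_assoc)
qed

text \<open>Being fixed under conjugation by \<open>N_beta d\<close> means commuting with it, and
  \<open>N_beta d\<close> is the conjugate by \<open>M_mat d\<close> of the block diagonal companion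
  matrix.\<close>

lemma hat_Sp_fixed_iff:
  assumes "d \<noteq> 0"
  shows "hat_Sp d (M_mat d ** g ** matrix_inv (M_mat d)) = M_mat d ** g ** matrix_inv (M_mat d) \<longleftrightarrow>
    block (beta0 d) 0 0 (transpose (beta0 d)) ** g = g ** block (beta0 d) 0 0 (transpose (beta0 d))"
proof -
  let ?N = "N_beta d" and ?M = "M_mat d" and ?K = "block (beta0 d) 0 0 (transpose (beta0 d))"
  let ?h = "?M ** g ** matrix_inv ?M"
  note cancel = matrix_inv_cancel[OF invertible_M_mat] matrix_inv_cancel[OF invertible_N_beta[OF assms]]
  have N: "?N = ?M ** ?K ** matrix_inv ?M"
    by (simp add: cancel flip: N_beta_M_mat)
  have "hat_Sp d ?h = ?h \<longleftrightarrow> ?N ** ?h = ?h ** ?N"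
    by (simp add: hat_Sp_def matrix_mult_inv_eq_iff invertible_N_beta assms)
  also have "?N ** ?h = ?M ** (?K ** g) ** matrix_inv ?M"
    by (simp add: N matrix_mul_assoc cancel)
  also have "?h ** ?N = ?M ** (g ** ?K) ** matrix_inv ?M"
    by (simp add: N matrix_mul_assoc cancel)
  also have "?M ** X ** matrix_inv ?M = ?M ** Y ** matrix_inv ?M \<longleftrightarrow> X = Y" for X Y
    by (simp add: matrix_mult_cancel invertible_M_mat invertible_matrix_inv)
  finally show ?thesis .
qed

text \<open>Both directions are conjugation by a similitude: \<open>M_mat d\<close>, or its inverse
  with the reciprocal multiplier.\<close>

lemma Sp4_M_mat_conj_iff: "M_mat d ** g ** matrix_inv (M_mat d) \<in> Sp4 \<longleftrightarrow> g \<in> Sp4"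
proof
  assume "M_mat d ** g ** matrix_inv (M_mat d) \<in> Sp4"
  moreover have "invertible (matrix_inv (M_mat d))"
    by (simp add: invertible_matrix_inv invertible_M_mat)
  moreover have "transpose (matrix_inv (M_mat d)) ** symplectic_form ** matrix_inv (M_mat d) =
      (1 / M_factor d) *\<^sub>R symplectic_form"
    using M_factor_pos[of d]
    by (intro symplectic_form_similitude_inv invertible_M_mat M_mat_similitude) simp
  ultimately have "matrix_inv (M_mat d) ** (M_mat d ** g ** matrix_inv (M_mat d)) **
      matrix_inv (matrix_inv (M_mat d)) \<in> Sp4"
    using Sp4_similitude_conj by blast
  then show "g \<in> Sp4"
    by (simp add: matrix_inv_matrix_inv invertible_M_mat matrix_mul_assoc matrix_inv_cancel)
qed (intro Sp4_similitude_conj[OF invertible_M_mat M_mat_similitude])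

section \<open>Coordinates over \<open>sqrt d\<close> and the image of \<open>SL2C\<close>\<close>

lemma coord_add:
  "coord_a (x + y) = coord_a x + coord_a y" "coord_b d (x + y) = coord_b d x + coord_b d y"
  by (simp_all add: coord_a_def coord_b_def add_divide_distrib)

lemma coord_mult:
  assumes "d < 0"
  shows "coord_a (x * y) = coord_a x * coord_a y + of_int d * coord_b d x * coord_b d y"
    and "coord_b d (x * y) = coord_a x * coord_b d y + coord_b d x * coord_a y"
proof -
  have "sqrt (- of_int d) * sqrt (- of_int d) = - real_of_int d"
    using assms by simp
  then show "coord_a (x * y) = coord_a x * coord_a y + of_int d * coord_b d x * coord_b d y"
    using assms by (simp add: coord_a_def coord_b_def)
qed (simp add: coord_a_def coord_b_def add_divide_distrib)

lemma coord_of_coords: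
  assumes "d < 0"
  shows "coord_a (Complex a (b * sqrt (- of_int d))) = a"
    and "coord_b d (Complex a (b * sqrt (- of_int d))) = b"
  using assms by (simp_all add: coord_a_def coord_b_def)

lemma coord_eq_iff:
  assumes "d < 0"
  shows "x = y \<longleftrightarrow> coord_a x = coord_a y \<and> coord_b d x = coord_b d y"
  using assms by (simp add: coord_a_def coord_b_def complex_eq_iff)

lemma phi_SL0_mult:
  assumes "d < 0"
  shows "phi_SL0 d (g ** h) = phi_SL0 d g ** phi_SL0 d h"
  by (simp add: phi_SL0_def Let_def block_mult block_eq_iff mat_2_2_eq_iff matrix_mult_2_nth
      coord_add coord_mult[OF assms] algebra_simps)

lemma phi_SL0_one: "phi_SL0 d (mat 1) = mat 1"
proof -
  have "phi_SL0 d (mat 1) = block (mat 1) 0 0 (mat 1)"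
    by (simp add: phi_SL0_def coord_a_def coord_b_def mat_nth block_eq_iff mat_2_2_eq_iff)
  then show ?thesis
    by (simp add: block_mat)
qed

text \<open>The two symmetry conditions hold for every \<open>g\<close>. The remaining block
  expression is the transpose of \<open>a + b beta0\<close> with \<open>a\<close>, \<open>b\<close>
  the coordinates of \<open>det g\<close>, so it is the identity exactly when the determinant is
  1.\<close>

lemma phi_SL0_Sp4_iff:
  assumes "d < 0"
  shows "phi_SL0 d g \<in> Sp4 \<longleftrightarrow> det g = 1"
proof -
  have diff: "coord_a (x - y) = coord_a x - coord_a y" "coord_b d (x - y) = coord_b d x - coord_b d y" for x y
    by (simp_all add: coord_a_def coord_b_def diff_divide_distrib)
  let ?A = "blockA (phi_SL0 d g)" and ?B = "blockB (phi_SL0 d g)"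
    and ?C = "blockC (phi_SL0 d g)" and ?D = "blockD (phi_SL0 d g)"
  have "transpose ?A ** ?D - transpose ?C ** ?B =
    mat2 (coord_a (det g)) (of_int d * coord_b d (det g)) (coord_b d (det g)) (coord_a (det g))"
    by (simp add: phi_SL0_def Let_def mat_2_2_eq_iff matrix_mult_2_nth det_2 diff
        coord_mult[OF assms] algebra_simps)
  moreover have "symmetric_mat (transpose ?A ** ?C)" "symmetric_mat (transpose ?B ** ?D)"
    by (simp_all add: symmetric_mat_def phi_SL0_def Let_def mat_2_2_eq_iff matrix_mult_2_nth)
  moreover have "coord_a 1 = 1" "coord_b d 1 = 0"
    by (simp_all add: coord_a_def coord_b_def)
  ultimately show ?thesis
    using assms by (auto simp: Sp4_def mat_2_2_eq_iff mat_nth coord_eq_iff[OF assms])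
qed

text \<open>The matrices commuting with \<open>beta0 d\<close> are the combinations
  \<open>a + b beta0\<close>, and the other blocks are such combinations multiplied by the swap.
  Hence the centralizer consists of the restrictions of scalars of all complex matrices, with no
  condition yet on the determinant.\<close>

lemma commute_beta0_iff:
  assumes "d < 0"
  shows "block (beta0 d) 0 0 (transpose (beta0 d)) ** g = g ** block (beta0 d) 0 0 (transpose (beta0 d))
    \<longleftrightarrow> (\<exists>h. g = phi_SL0 d h)"
proof -
  let ?N = "block (beta0 d) 0 0 (transpose (beta0 d))"
  have "?N ** phi_SL0 d h = phi_SL0 d h ** ?N" for h
    by (simp add: phi_SL0_def Let_def block_mult block_eq_iff beta0_def mat_2_2_eq_iff matrix_mult_2_nth)
  moreover have "\<exists>h. g = phi_SL0 d h" if comm: "?N ** g = g ** ?N"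
  proof -
    define A B C D where "A = blockA g" "B = blockB g" "C = blockC g" "D = blockD g"
    have g: "g = block A B C D"
      by (simp add: A_B_C_D_def)
    \<comment> \<open>As \<open>d\<close> is negative, \<open>c a b\<close> is the complex number
      \<open>a + b sqrt d\<close>.\<close>
    define c where "c a b = Complex a (b * sqrt (- of_int d))" for a b
    have eqs: "beta0 d ** A = A ** beta0 d" "beta0 d ** B = B ** transpose (beta0 d)"
      "transpose (beta0 d) ** C = C ** beta0 d" "transpose (beta0 d) ** D = D ** transpose (beta0 d)"
      using comm by (simp_all add: g block_mult block_eq_iff)
    \<comment> \<open>Two entries of each commutation relation already determine the shape of the
      block. The two free entries become the coordinates of one complex entry.\<close>
    have "A$2$1 = of_int d * A$1$2" "A$2$2 = A$1$1"
      using eqs(1)[THEN arg_cong, of "\<lambda>X. X$1$1"] eqs(1)[THEN arg_cong, of "\<lambda>X. X$1$2"]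
      by (simp_all add: beta0_def matrix_mult_2_nth)
    moreover have "B$2$1 = B$1$2" "B$2$2 = of_int d * B$1$1"
      using eqs(2)[THEN arg_cong, of "\<lambda>X. X$1$1"] eqs(2)[THEN arg_cong, of "\<lambda>X. X$1$2"]
      by (simp_all add: beta0_def matrix_mult_2_nth)
    moreover have "C$1$1 = of_int d * C$2$2" "C$2$1 = C$1$2"
      using eqs(3)[THEN arg_cong, of "\<lambda>X. X$2$1"] eqs(3)[THEN arg_cong, of "\<lambda>X. X$2$2"]
      by (simp_all add: beta0_def matrix_mult_2_nth)
    moreover have "D$2$2 = D$1$1" "D$1$2 = of_int d * D$2$1"
      using eqs(4)[THEN arg_cong, of "\<lambda>X. X$2$1"] eqs(4)[THEN arg_cong, of "\<lambda>X. X$2$2"]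
      by (simp_all add: beta0_def matrix_mult_2_nth)
    ultimately have "g = phi_SL0 d (mat2 (c (A$1$1) (A$1$2)) (c (B$1$2) (B$1$1)) (c (C$1$2) (C$2$2)) (c (D$1$1) (D$2$1)))"
      using assms
      by (simp add: g phi_SL0_def Let_def block_mult block_eq_iff beta0_def mat_2_2_eq_iff matrix_mult_2_nth
          c_def coord_of_coords)
    then show ?thesis ..
  qed
  ultimately show ?thesis
    by blast
qed

lemma hat_Sp_fixed_points:
  assumes "d < 0"
  shows "{g \<in> Sp4. hat_Sp d g = g} = phi_SL d ` carrier SL2C"
proof (intro equalityI subsetI)
  fix g assume g: "g \<in> {g \<in> Sp4. hat_Sp d g = g}"
  define g0 where "g0 = matrix_inv (M_mat d) ** g ** M_mat d"
  have g_eq: "g = M_mat d ** g0 ** matrix_inv (M_mat d)"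
    by (simp add: g0_def matrix_mul_assoc matrix_inv_cancel invertible_M_mat)
  obtain h where h: "g0 = phi_SL0 d h"
    using g assms hat_Sp_fixed_iff[of d g0] commute_beta0_iff[of d g0] by (auto simp flip: g_eq)
  moreover have "det h = 1"
    using g assms by (simp add: g_eq Sp4_M_mat_conj_iff h phi_SL0_Sp4_iff)
  ultimately show "g \<in> phi_SL d ` carrier SL2C"
    by (auto simp: SL2C_def g_eq phi_SL_eq)
next
  fix g assume "g \<in> phi_SL d ` carrier SL2C"
  then obtain h where "g = M_mat d ** phi_SL0 d h ** matrix_inv (M_mat d)" "det h = 1"
    by (auto simp: SL2C_def phi_SL_eq)
  then show "g \<in> {g \<in> Sp4. hat_Sp d g = g}"
    using assms commute_beta0_iff[of d "phi_SL0 d h"]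
    by (auto simp: Sp4_M_mat_conj_iff hat_Sp_fixed_iff phi_SL0_Sp4_iff)
qed

section \<open>The involution on the Siegel space\<close>

text \<open>The involution is complex conjugation followed by the block diagonal map of
  \<open>N_beta d\<close>. The first commutes with \<open>g\<close> because \<open>g\<close> is
  real, the second turns \<open>g\<close> into its conjugate.\<close>

lemma hat_siegel_Sp_act:
  assumes "d \<noteq> 0" "g \<in> Sp4" "Z \<in> siegel"
  shows "hat_siegel d (Sp_act g Z) = Sp_act (hat_Sp d g) (hat_siegel d Z)"
proof -
  let ?Q = "cmat (blockC g) ** Z + cmat (blockD g)"
  have Q: "invertible ?Q"
    using assms Sp4_cocycle_invertible by blast
  have cnj_Q: "cnj_mat ?Q = cmat (blockC g) ** cnj_mat Z + cmat (blockD g)"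
    by (simp add: cnj_mat_add cnj_mat_mult)
  have act: "Sp_act g (cnj_mat Z) = cnj_mat (Sp_act g Z)"
    by (simp add: Sp_act_def cnj_mat_mult cnj_mat_add cnj_mat_matrix_inv[OF Q])
  have "invertible (cmat (blockC g) ** cnj_mat Z + cmat (blockD g))"
    using invertible_cnj_mat[OF Q] by (simp add: cnj_Q)
  then show ?thesis
    using Sp_act_block_diag_conj[of "beta d" "transpose (beta d)" g "cnj_mat Z"]
    by (simp add: hat_siegel_def hat_Sp_def N_beta_def act transpose_cmat invertible_beta assms
        transpose_invertible)
qed

lemma hat_siegel_fixed_iff:
  assumes "d \<noteq> 0"
  shows "hat_siegel d (cmat (sigma d) ** Z ** transpose (cmat (sigma d))) =
      cmat (sigma d) ** Z ** transpose (cmat (sigma d)) \<longleftrightarrow>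
    cmat (beta0 d) ** cnj_mat Z = Z ** transpose (cmat (beta0 d))"
proof -
  let ?s = "cmat (sigma d)" and ?b = "cmat (beta d)" and ?c = "cmat (beta0 d)"
  let ?Z = "?s ** Z ** transpose ?s"
  have s: "invertible ?s" "invertible (transpose ?s)" "invertible (transpose ?b)"
    by (simp_all add: transpose_cmat invertible_cmat invertible_sigma transpose_invertible invertible_beta assms)
  have bs: "?b ** ?s = ?s ** ?c"
    by (simp add: beta_sigma flip: cmat_mult)
  have "hat_siegel d ?Z = ?Z \<longleftrightarrow> ?b ** cnj_mat ?Z = ?Z ** transpose ?b"
    by (simp add: hat_siegel_def matrix_mult_inv_eq_iff s)
  also have "?b ** cnj_mat ?Z = (?b ** ?s) ** cnj_mat Z ** transpose ?s"
    by (simp add: cnj_mat_mult matrix_mul_assoc transpose_cmat)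
  also have "\<dots> = ?s ** (?c ** cnj_mat Z) ** transpose ?s"
    by (simp add: bs matrix_mul_assoc)
  also have "?Z ** transpose ?b = ?s ** Z ** transpose (?b ** ?s)"
    by (simp add: matrix_transpose_mul matrix_mul_assoc)
  also have "\<dots> = ?s ** (Z ** transpose ?c) ** transpose ?s"
    by (simp add: bs matrix_transpose_mul matrix_mul_assoc)
  also have "?s ** X ** transpose ?s = ?s ** Y ** transpose ?s \<longleftrightarrow> X = Y" for X Y
    by (simp add: matrix_mult_cancel s)
  finally show ?thesis .
qed

lemma phi_H0_siegel:
  assumes "d < 0" "x \<in> H3"
  shows "phi_H0 d x \<in> siegel"
proof -
  obtain z r where x: "x = (z, r)" and z: "Im z > 0"
    using assms(2) by (auto simp: H3_def)
  let ?Y = "Im_mat (phi_H0 d x)"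
  have "0 < v \<bullet> (?Y *v v)" if "v \<noteq> 0" for v
  proof -
    \<comment> \<open>The off-diagonal entries \<open>r\<close> are real and conjugation in the last
      entry flips the sign, so the imaginary part is \<open>Im z\<close> times the diagonal matrix
      with entries 1 and \<open>- d\<close>.\<close>
    have "v \<bullet> (?Y *v v) = Im z * ((v$1)\<^sup>2 + (- of_int d) * (v$2)\<^sup>2)"
      by (simp add: x phi_H0_def inner_vec_def matrix_vector_mult_def sum_2 power2_eq_square algebra_simps)
    moreover have "v$1 \<noteq> 0 \<or> v$2 \<noteq> 0"
      using that by (auto simp: vec_eq_iff forall_2)
    then have "0 < (v$1)\<^sup>2 + (- of_int d) * (v$2)\<^sup>2"
    proof
      assume "v$1 \<noteq> 0"
      then show ?thesis
        using assms(1) by (intro add_pos_nonneg mult_nonneg_nonneg) auto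
    next
      assume "v$2 \<noteq> 0"
      then show ?thesis
        using assms(1) by (intro add_nonneg_pos mult_pos_pos) auto
    qed
    ultimately show ?thesis
      using z by simp
  qed
  then show ?thesis
    by (auto simp: siegel_def pos_def_mat_def symmetric_mat_def x phi_H0_def mat_2_2_eq_iff)
qed

lemma hat_siegel_fixed_points:
  assumes "d < 0"
  shows "{Z \<in> siegel. hat_siegel d Z = Z} = phi_H d ` H3"
proof (intro equalityI subsetI)
  fix Z assume Z: "Z \<in> {Z \<in> siegel. hat_siegel d Z = Z}"
  define s where "s = matrix_inv (sigma d)"
  define W where "W = cmat s ** Z ** transpose (cmat s)"
  have inv: "cmat (sigma d) ** cmat s = mat 1" "transpose (cmat s) ** transpose (cmat (sigma d)) = mat 1"
    by (simp_all add: s_def invertible_sigma flip: cmat_mult matrix_transpose_mul)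
  then have Z_eq: "Z = cmat (sigma d) ** W ** transpose (cmat (sigma d))"
    unfolding W_def by (metis matrix_mul_assoc matrix_mul_lid matrix_mul_rid)
  have fixed: "cmat (beta0 d) ** cnj_mat W = W ** transpose (cmat (beta0 d))"
    using Z assms hat_siegel_fixed_iff[of d W] by (simp flip: Z_eq)
  have W: "W \<in> siegel"
    unfolding W_def using Z by (intro siegel_conj) (auto simp: s_def invertible_matrix_inv invertible_sigma)
  then have "transpose W = W"
    by (simp add: siegel_def symmetric_mat_def)
  then have sym: "W$2$1 = W$1$2"
    by (metis transpose_nth)
  \<comment> \<open>The upper left entry of the fixed point equation makes \<open>r\<close> real,
    the lower left one determines the last diagonal entry from the first.\<close>
  have "cnj (W$1$2) = W$1$2" "W$2$2 = of_int d * cnj (W$1$1)"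
    using fixed[THEN arg_cong, of "\<lambda>X. X$1$1"] fixed[THEN arg_cong, of "\<lambda>X. X$2$1"]
    by (simp_all add: beta0_def matrix_mult_2_nth sym)
  then have "W = phi_H0 d (W$1$1, Re (W$1$2))"
    by (simp add: phi_H0_def mat_2_2_eq_iff sym) (simp add: complex_eq_iff)
  \<comment> \<open>Positivity at the first basis vector is the condition \<open>Im z > 0\<close>
    defining \<open>H3\<close>.\<close>
  moreover have "0 < axis 1 1 \<bullet> (Im_mat W *v axis 1 1)"
    using W by (auto simp: siegel_def pos_def_mat_def axis_eq_0_iff)
  then have "(W$1$1, Re (W$1$2)) \<in> H3"
    by (simp add: H3_def matrix_vector_mult_basis inner_axis' column_def)
  ultimately show "Z \<in> phi_H d ` H3"
    by (metis Z_eq phi_H_eq imageI)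
next
  fix Z assume "Z \<in> phi_H d ` H3"
  then obtain x where x: "Z = cmat (sigma d) ** phi_H0 d x ** transpose (cmat (sigma d))" "x \<in> H3"
    by (auto simp: phi_H_eq)
  have "cmat (beta0 d) ** cnj_mat (phi_H0 d x) = phi_H0 d x ** transpose (cmat (beta0 d))"
    by (cases x) (simp add: beta0_def phi_H0_def mat_2_2_eq_iff matrix_mult_2_nth)
  then show "Z \<in> {Z \<in> siegel. hat_siegel d Z = Z}"
    using assms x by (simp add: hat_siegel_fixed_iff siegel_conj invertible_sigma phi_H0_siegel)
qed

subsection \<open>The action on hyperbolic space\<close>

text \<open>Reduces an action to the pointwise laws: each map is a bijection because the map of the
  inverse element undoes it.\<close>

lemma group_actionI:
  fixes G (structure)
  assumes "group G"
    and ext: "\<And>g. g \<in> carrier G \<Longrightarrow> \<phi> g \<in> extensional E"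
    and closed: "\<And>g x. g \<in> carrier G \<Longrightarrow> x \<in> E \<Longrightarrow> \<phi> g x \<in> E"
    and one: "\<And>x. x \<in> E \<Longrightarrow> \<phi> \<one> x = x"
    and mult: "\<And>g h x. g \<in> carrier G \<Longrightarrow> h \<in> carrier G \<Longrightarrow> x \<in> E \<Longrightarrow> \<phi> (g \<otimes> h) x = \<phi> g (\<phi> h x)"
  shows "group_action G E \<phi>"
proof -
  interpret group G by fact
  have bij: "\<phi> g \<in> Bij E" if g: "g \<in> carrier G" for g
  proof -
    have "\<phi> (inv g) (\<phi> g x) = x" "\<phi> g (\<phi> (inv g) x) = x" if "x \<in> E" for x
      using g that by (simp_all add: one flip: mult)
    then have "bij_betw (\<phi> g) E E"
      using g by (intro bij_betw_byWitness[where f' = "\<phi> (inv g)"]) (auto simp: closed)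
    then show ?thesis
      using ext[OF g] by (simp add: Bij_def)
  qed
  have "\<phi> \<in> hom G (BijGroup E)"
  proof (rule homI)
    fix g h assume gh: "g \<in> carrier G" "h \<in> carrier G"
    have "\<phi> (g \<otimes> h) = compose E (\<phi> g) (\<phi> h)"
      using gh by (intro extensionalityI[of _ E]) (simp_all add: ext mult compose_eq)
    then show "\<phi> (g \<otimes> h) = \<phi> g \<otimes>\<^bsub>BijGroup E\<^esub> \<phi> h"
      using gh by (simp add: BijGroup_def bij)
  qed (simp add: BijGroup_def bij)
  then show ?thesis
    by (simp add: group_action_def group_hom_def group_hom_axioms_def group_BijGroup group_axioms)
qed

lemma group_SL2C: "group SL2C"
proof (rule groupI)
  fix g assume "g \<in> carrier SL2C"
  then have g: "det g = 1"
    by (simp add: SL2C_def)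
  then have inv: "invertible g"
    by (simp add: invertible_det_nz)
  then have "det (matrix_inv g) * det g = 1"
    by (simp flip: det_mul)
  with g inv show "\<exists>h\<in>carrier SL2C. h \<otimes>\<^bsub>SL2C\<^esub> g = \<one>\<^bsub>SL2C\<^esub>"
    by (intro bexI[of _ "matrix_inv g"]) (simp_all add: SL2C_def)
qed (simp_all add: SL2C_def det_mul matrix_mul_assoc)

lemma phi_SL_mult:
  assumes "d < 0"
  shows "phi_SL d (g ** h) = phi_SL d g ** phi_SL d h"
  by (simp add: phi_SL_eq phi_SL0_mult assms matrix_mul_assoc matrix_inv_cancel invertible_M_mat)

lemma phi_SL_one: "phi_SL d (mat 1) = mat 1"
  by (simp add: phi_SL_eq phi_SL0_one invertible_M_mat)

lemma Sp_act_one: "Sp_act (mat 1) Z = Z"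
  using block_sel[of "mat 1" 0 0 "mat 1 :: real^2^2"] by (simp add: Sp_act_def block_mat)

lemma inj_phi_H: "inj (phi_H d)"
proof (rule injI)
  fix x y assume "phi_H d x = phi_H d y"
  then have "phi_H0 d x = phi_H0 d y"
    by (simp add: phi_H_eq matrix_mult_cancel transpose_cmat invertible_cmat invertible_sigma
        invertible_transpose_sigma)
  then show "x = y"
    by (simp add: phi_H0_def mat_2_2_eq_iff split: prod.splits)
qed

text \<open>Both points are fixed by their involutions, and compatibility carries this over to the
  image, which therefore lies in the fixed point set again.\<close>

lemma Sp_act_phi:
  assumes "d < 0" "g \<in> carrier SL2C" "x \<in> H3"
  shows "Sp_act (phi_SL d g) (phi_H d x) \<in> phi_H d ` H3"
proof -
  have "phi_SL d g \<in> {g \<in> Sp4. hat_Sp d g = g}"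
    using assms by (simp only: hat_Sp_fixed_points imageI)
  moreover have "phi_H d x \<in> {Z \<in> siegel. hat_siegel d Z = Z}"
    using assms by (simp only: hat_siegel_fixed_points imageI)
  ultimately have "Sp_act (phi_SL d g) (phi_H d x) \<in> {Z \<in> siegel. hat_siegel d Z = Z}"
    using assms(1) by (simp add: Sp_act_siegel hat_siegel_Sp_act)
  then show ?thesis
    using assms(1) by (simp only: hat_siegel_fixed_points)
qed

lemma Sp_act_phi_mult:
  assumes "d < 0" "g \<in> carrier SL2C" "h \<in> carrier SL2C" "x \<in> H3"
  shows "Sp_act (phi_SL d (g ** h)) (phi_H d x) = Sp_act (phi_SL d g) (Sp_act (phi_SL d h) (phi_H d x))"
proof -
  have "phi_SL d g \<in> Sp4" "phi_SL d h \<in> Sp4"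
    using assms hat_Sp_fixed_points[of d] by blast+
  moreover have "phi_H d x \<in> siegel"
    using assms hat_siegel_fixed_points[of d] by blast
  ultimately show ?thesis
    using assms(1) by (simp add: phi_SL_mult Sp_act_mult Sp4_cocycle_invertible Sp_act_siegel)
qed

section \<open>Transitivity\<close>

lemma cmat_scaleR: "cmat (k *\<^sub>R A) = k *\<^sub>R cmat A"
  by (simp add: vec_eq_iff complex_eq_iff)

text \<open>The block diagonal map of \<open>M_mat d\<close> sends \<open>Z\<close> to its
  congruence by \<open>sigma d\<close> divided by \<open>M_factor d\<close>. So
  \<open>phi_H d x\<close> corresponds to the multiple \<open>M_factor d\<close> of
  \<open>phi_H0 d x\<close>, and transitivity has to be shown on these rescaled points.\<close>

lemma phi_H_eq_M_factor:
  "cmat (sigma d) ** (M_factor d *\<^sub>R phi_H0 d x) **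
    matrix_inv (cmat (M_factor d *\<^sub>R matrix_inv (transpose (sigma d)))) = phi_H d x"
proof -
  let ?k = "M_factor d" and ?t = "transpose (sigma d)"
  have "(?k *\<^sub>R matrix_inv ?t) ** ((1 / ?k) *\<^sub>R ?t) = mat 1"
    using M_factor_pos[of d]
    by (simp add: invertible_transpose_sigma matrix_scalar_ac flip: scalar_matrix_assoc)
  then have inv: "matrix_inv (?k *\<^sub>R matrix_inv ?t) = (1 / ?k) *\<^sub>R ?t"
    by (rule matrix_inv_unique)
  have "matrix_inv (cmat (?k *\<^sub>R matrix_inv ?t)) = cmat (matrix_inv (?k *\<^sub>R matrix_inv ?t))"
    by (rule cmat_matrix_inv[OF invertible_M_block, symmetric])
  also have "\<dots> = (1 / ?k) *\<^sub>R transpose (cmat (sigma d))"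
    by (simp only: inv cmat_scaleR transpose_cmat)
  finally show ?thesis
    using M_factor_pos[of d]
    by (simp add: phi_H_eq matrix_scalar_ac flip: scalar_matrix_assoc)
qed

text \<open>Upper triangular matrices with positive real diagonal already act transitively:
  the diagonal adjusts \<open>Im z\<close>, the unipotent part translates \<open>Re z\<close> and \<open>r\<close>.\<close>

lemma phi_SL0_upper_transitive:
  assumes d: "d < 0" and "x \<in> H3" "y \<in> H3" and k: "k > 0"
  obtains g where "g \<in> carrier SL2C" "blockC (phi_SL0 d g) = 0" "invertible (blockD (phi_SL0 d g))"
    "Sp_act (phi_SL0 d g) (k *\<^sub>R phi_H0 d x) = k *\<^sub>R phi_H0 d y"
proof -
  obtain z r w s where xy: "x = (z, r)" "y = (w, s)" and pos: "Im z > 0" "Im w > 0"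
    using assms by (auto simp: H3_def)
  \<comment> \<open>With diagonal \<open>t\<close>, \<open>1 / t\<close> the action is
    \<open>Z\<close> to \<open>t * t\<close> times \<open>Z\<close> plus \<open>t\<close> times the
    upper right block. Imaginary parts force this \<open>t\<close>; the real part of the first entry
    and the off-diagonal entry then force \<open>b2\<close> and \<open>a2\<close>.\<close>
  define t where "t = sqrt (Im w / Im z)"
  have t: "t > 0" "t * t = Im w / Im z"
    using pos by (simp_all add: t_def)
  define a2 b2 where "a2 = k * (s - t * t * r) / t" and "b2 = k * (Re w - t * t * Re z) / t"
  define g where "g = mat2 (of_real t) (Complex a2 (b2 * sqrt (- of_int d))) 0 (of_real (1 / t))"
  have "det g = 1"
    using t(1) by (simp add: g_def det_2 field_simps)
  have phi: "phi_SL0 d g = block (mat2 t 0 0 t) (mat2 b2 a2 a2 (b2 * of_int d)) 0 (mat2 (1 / t) 0 0 (1 / t))"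
  proof -
    have "coord_a (of_real u) = u" "coord_b d (of_real u) = 0" "coord_a 0 = 0" "coord_b d 0 = 0" for u
      by (simp_all add: coord_a_def coord_b_def)
    then show ?thesis
      by (simp add: phi_SL0_def Let_def g_def coord_of_coords d block_eq_iff mat_2_2_eq_iff
          del: of_real_divide)
  qed
  have D: "mat2 (1 / t) 0 0 (1 / t) ** mat2 t 0 0 t = mat 1"
    using t(1) by (simp add: mat_2_2_eq_iff matrix_mult_2_nth mat_nth)
  have inv: "matrix_inv (cmat (mat2 (1 / t) 0 0 (1 / t))) = cmat (mat2 t 0 0 t)"
    using matrix_inv_unique[OF D] by (simp flip: cmat_matrix_inv)
  have "Sp_act (phi_SL0 d g) (k *\<^sub>R phi_H0 d x) = k *\<^sub>R phi_H0 d y"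
  proof -
    have eqs: "t * b2 = k * (Re w - t * t * Re z)" "t * a2 = k * (s - t * t * r)" "t * t * Im z = Im w"
      using t pos by (simp_all add: a2_def b2_def)
    have 1: "(k * (t * Re z) + b2) * t = k * Re w" "t * (Im z * t) = Im w"
      "(k * (t * r) + a2) * t = k * s"
      using eqs by algebra+
    \<comment> \<open>The last diagonal entry holds no new condition: its real part is
      \<open>d\<close> times that of the first.\<close>
    have 2: "(k * (t * (of_int d * Re z)) + b2 * of_int d) * t = k * (of_int d * Re w)"
      using eqs by algebra
    show ?thesis
      using 1 2 by (simp add: Sp_act_def phi inv xy phi_H0_def mat_2_2_eq_iff matrix_mult_2_nth complex_eq_iff)
  qed
  with \<open>det g = 1\<close> matrix_inv_unique(2)[OF D] show thesis
    by (intro that[of g]) (simp_all add: SL2C_def phi)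
qed

lemma Sp_act_phi_transitive:
  assumes "d < 0" "x \<in> H3" "y \<in> H3"
  shows "\<exists>g\<in>carrier SL2C. Sp_act (phi_SL d g) (phi_H d x) = phi_H d y"
proof -
  obtain g where g: "g \<in> carrier SL2C" "blockC (phi_SL0 d g) = 0" "invertible (blockD (phi_SL0 d g))"
    "Sp_act (phi_SL0 d g) (M_factor d *\<^sub>R phi_H0 d x) = M_factor d *\<^sub>R phi_H0 d y"
    using phi_SL0_upper_transitive[OF assms M_factor_pos] .
  have "Sp_act (phi_SL d g) (phi_H d x) = phi_H d y"
    using Sp_act_block_diag_conj[OF invertible_sigma invertible_M_block,
        of "phi_SL0 d g" "M_factor d *\<^sub>R phi_H0 d x" d d] g
    by (simp add: phi_SL_eq M_mat_eq phi_H_eq_M_factor invertible_cmat)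
  with g(1) show ?thesis ..
qed

section \<open>Existence, uniqueness and transitivity of the action\<close>

text \<open>The action is pulled back along the injection \<open>phi_H d\<close>, whose image is
  preserved. Injectivity transfers the action laws to \<open>H3\<close> and also forces
  uniqueness.\<close>

lemma ex1_compatible_action:
  assumes d: "d < 0"
  shows "\<exists>!act. compatible_action d act"
proof (rule ex_ex1I)
  \<comment> \<open>Both abstractions are restricted, giving the extensionality in \<open>g\<close>
    and in \<open>x\<close> that \<open>compatible_action\<close> demands.\<close>
  define act where "act = (\<lambda>g\<in>carrier SL2C. \<lambda>x\<in>H3.
    inv_into H3 (phi_H d) (Sp_act (phi_SL d g) (phi_H d x)))"
  have act: "act g x \<in> H3" "phi_H d (act g x) = Sp_act (phi_SL d g) (phi_H d x)"
    if "g \<in> carrier SL2C" "x \<in> H3" for g x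
    using Sp_act_phi[OF d that] that by (simp_all add: act_def inv_into_into f_inv_into_f)
  have ext: "act g \<in> extensional H3" if "g \<in> carrier SL2C" for g
    using that by (simp add: act_def)
  have "group_action SL2C H3 act"
  proof (rule group_actionI[OF group_SL2C])
    fix g h x assume gh: "g \<in> carrier SL2C" "h \<in> carrier SL2C" and x: "x \<in> H3"
    then have "g \<otimes>\<^bsub>SL2C\<^esub> h \<in> carrier SL2C"
      by (simp add: SL2C_def det_mul)
    then have "phi_H d (act (g \<otimes>\<^bsub>SL2C\<^esub> h) x) = phi_H d (act g (act h x))"
      using gh x Sp_act_phi_mult[OF d gh x] by (simp add: act) (simp add: SL2C_def)
    then show "act (g \<otimes>\<^bsub>SL2C\<^esub> h) x = act g (act h x)"
      by (rule injD[OF inj_phi_H])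
  next
    fix x assume x: "x \<in> H3"
    have "\<one>\<^bsub>SL2C\<^esub> = mat 1" "mat 1 \<in> carrier SL2C"
      by (simp_all add: SL2C_def)
    then have "phi_H d (act \<one>\<^bsub>SL2C\<^esub> x) = phi_H d x"
      using x by (simp add: act phi_SL_one Sp_act_one)
    then show "act \<one>\<^bsub>SL2C\<^esub> x = x"
      by (rule injD[OF inj_phi_H])
  qed (simp_all add: ext act)
  then show "\<exists>act. compatible_action d act"
    using act unfolding compatible_action_def
    by (intro exI[of _ act]) (auto simp: act_def)
next
  fix act act' assume act: "compatible_action d act" "compatible_action d act'"
  show "act = act'"
  proof (rule extensionalityI)
    show "act \<in> extensional (carrier SL2C)" "act' \<in> extensional (carrier SL2C)"
      using act by (simp_all add: compatible_action_def)
    fix g assume g: "g \<in> carrier SL2C"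
    show "act g = act' g"
    proof (rule extensionalityI)
      \<comment> \<open>Off \<open>H3\<close> both maps take the default value, since an action has
        values in the extensional bijections of \<open>H3\<close>. Only points of \<open>H3\<close>
        remain to be compared.\<close>
      show "act g \<in> extensional H3" "act' g \<in> extensional H3"
        using act g group_action.bij_prop0[THEN Bij_imp_extensional]
        by (auto simp: compatible_action_def)
      fix x assume "x \<in> H3"
      then have "phi_H d (act g x) = phi_H d (act' g x)"
        using act g by (simp add: compatible_action_def)
      then show "act g x = act' g x"
        by (rule injD[OF inj_phi_H])
    qed
  qed
qed

lemma compatible_action_transitive:
  assumes "d < 0" "compatible_action d act"
  shows "transitive_action SL2C H3 act"
proof -
  interpret group_action SL2C H3 act
    using assms(2) by (simp add: compatible_action_def)
  show ?thesis
  proof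
    fix x y assume "x \<in> H3" "y \<in> H3"
    then obtain g where g: "g \<in> carrier SL2C" "Sp_act (phi_SL d g) (phi_H d x) = phi_H d y"
      using Sp_act_phi_transitive assms(1) by blast
    then have "phi_H d (act g x) = phi_H d y"
      using assms(2) \<open>x \<in> H3\<close> by (simp add: compatible_action_def)
    then show "\<exists>g\<in>carrier SL2C. act g x = y"
      using g(1) injD[OF inj_phi_H] by blast
  qed
qed

theorem proposition2p5:
  fixes d :: int
  assumes "d < 0" and "squarefree d"
  shows "(\<forall>g \<in> Sp4. \<forall>x \<in> siegel. hat_siegel d (Sp_act g x) = Sp_act (hat_Sp d g) (hat_siegel d x))
    \<and> {g \<in> Sp4. hat_Sp d g = g} = phi_SL d ` carrier SL2C
    \<and> {x \<in> siegel. hat_siegel d x = x} = phi_H d ` H3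
    \<and> (\<exists>!act. compatible_action d act)
    \<and> (\<forall>act. compatible_action d act \<longrightarrow> transitive_action SL2C H3 act)"
  using assms(1) hat_siegel_Sp_act[of d] hat_Sp_fixed_points hat_siegel_fixed_points
    ex1_compatible_action compatible_action_transitive
  by auto

end
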